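(* For every $n\geq 2$, the undirected graph underlying the Hanoi-Fibonacci graph $\mathcal{F}_n$ is non-planar.
   Context: Disks $1,\dots,n$, $\Delta_k=\{1,\dots,k\}$ ($\varnothing$ for $k<1$). A state is an ordered triple $(A,B,C)$ of pairwise disjoint sets with union $\Delta_n$ (each peg stacked in decreasing order, top = minimum); there are $3^n$ states. For $k\in\Delta_n$, a $k$-Fibonacci move is defined when two distinct pegs $X,Y$ satisfy $X=k\tilde X$, $Y=\Delta_{k-1}\tilde Y$ (all disks of $\tilde X,\tilde Y$ larger than $k$) and the third peg $Z$ contains only disks larger than $k$; it yields $\tilde{X}\sqcup \Delta_{k-2}\tilde{Y}\sqcup (k-1)kZ$ (disks $k-1,k$ put simultaneously onto $Z$; peg positions preserved). A Fibonacci move is a $k$-Fibonacci move for some $k$. $\mathcal{F}_n$ is the directed graph whose vertices are the $3^n$ states and with an arc from $e$ to $e'$ whenever a Fibonacci move takes $e$ to $e'$. *)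

theory Defs
  imports "HOL-Analysis.Analysis" "Graph_Theory.Graph_Theory"
begin

section \<open>States and Fibonacci moves\<close>

text \<open>
  A state is an ordered triple of sets of disks, represented as a function on the three peg
  positions. Since every peg is stacked in decreasing order, the set of its disks determines the
  peg; its topmost disk is the minimum.
\<close>

datatype peg = PegA | PegB | PegC

type_synonym hanoi_state = "peg \<Rightarrow> nat set"

definition disks :: "nat \<Rightarrow> nat set" where
  "disks k = {1..k}"

definition hanoi_states :: "nat \<Rightarrow> hanoi_state set" where
  "hanoi_states n =
     {e. (\<forall>p q. p \<noteq> q \<longrightarrow> e p \<inter> e q = {}) \<and> (\<Union>p. e p) = disks n}"

text \<open>
  The sets \<open>X'\<close> and \<open>Y'\<close> below are the remainders of the pegs \<open>X\<close> and \<open>Y\<close>. For small \<open>k\<close> the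
  truncated differences \<open>k - 1\<close> and \<open>k - 2\<close> are 0, and \<open>disks 0\<close> is empty, in agreement with the
  convention that there are no disks below index 1. In particular there is no disk 0, so for
  \<open>k = 1\<close> only disk 1 is put onto \<open>Z\<close>; this is the purpose of the intersection with \<open>disks k\<close>.
\<close>

definition fibonacci_move_of :: "nat \<Rightarrow> hanoi_state \<Rightarrow> hanoi_state \<Rightarrow> bool" where
  "fibonacci_move_of k e e' \<longleftrightarrow>
     (\<exists>X Y Z X' Y'. X \<noteq> Y \<and> Y \<noteq> Z \<and> X \<noteq> Z
        \<and> (\<forall>d\<in>X'. k < d) \<and> (\<forall>d\<in>Y'. k < d)
        \<and> e X = {k} \<union> X' \<and> e Y = disks (k - 1) \<union> Y' \<and> (\<forall>d\<in>e Z. k < d)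
        \<and> e' X = X' \<and> e' Y = disks (k - 2) \<union> Y'
        \<and> e' Z = ({k - 1, k} \<inter> disks k) \<union> e Z)"

definition fibonacci_move :: "nat \<Rightarrow> hanoi_state \<Rightarrow> hanoi_state \<Rightarrow> bool" where
  "fibonacci_move n e e' \<longleftrightarrow> (\<exists>k\<in>disks n. fibonacci_move_of k e e')"

definition hanoi_fibonacci :: "nat \<Rightarrow> hanoi_state pair_pre_digraph" where
  "hanoi_fibonacci n =
     \<lparr> pverts = hanoi_states n,
       parcs = {(e, e'). e \<in> hanoi_states n \<and> e' \<in> hanoi_states n \<and> fibonacci_move n e e'} \<rparr>"

section \<open>Planarity of undirected graphs\<close>

text \<open>
  As in \<open>Graph_Theory\<close>, an undirected graph is a symmetric digraph. A pair of opposite arcs is one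
  edge, which is drawn once.
\<close>

definition uedges :: "'a pair_pre_digraph \<Rightarrow> 'a set set" where
  "uedges G = {{u, v} | u v. (u, v) \<in> parcs G}"

text \<open>
  A drawing in the plane without crossings: distinct vertices go to distinct points, and an edge
  to a curve that joins the images of its ends, has no self-intersection, passes through no other
  vertex, and meets any other edge only in images of common ends. A simple path may be
  closed, but it is so only for a loop, as \<open>\<phi>\<close> is injective on the vertices.
\<close>

definition plane_drawing ::
  "'a pair_pre_digraph \<Rightarrow> ('a \<Rightarrow> complex) \<Rightarrow> ('a set \<Rightarrow> real \<Rightarrow> complex) \<Rightarrow> bool" where
  "plane_drawing G \<phi> \<gamma> \<longleftrightarrow>
     inj_on \<phi> (pverts G)
   \<and> (\<forall>E\<in>uedges G. simple_path (\<gamma> E) \<and> {pathstart (\<gamma> E), pathfinish (\<gamma> E)} = \<phi> ` E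
        \<and> path_image (\<gamma> E) \<inter> \<phi> ` pverts G = \<phi> ` E)
   \<and> (\<forall>E\<in>uedges G. \<forall>F\<in>uedges G. E \<noteq> F \<longrightarrow>
        path_image (\<gamma> E) \<inter> path_image (\<gamma> F) = \<phi> ` (E \<inter> F))"

definition planar :: "'a pair_pre_digraph \<Rightarrow> bool" where
  "planar G \<longleftrightarrow> (\<exists>\<phi> \<gamma>. plane_drawing G \<phi> \<gamma>)"

end

theory Submission
  imports Defs "HOL-Complex_Analysis.Winding_Numbers"
begin

text \<open>
  Already the moves of disks 1 and 2, with all others resting on one peg, give a subdivision of
  \<open>K\<^bsub>3,3\<^esub>\<close>. Writing a state as the pegs of disks 1 and 2, the paths AA-BA-CA-BB, AA-CB-AB-BB and
  AA-BC-AC-BB form a theta curve, and CC is adjacent to the inner vertices BA, AB and AC. In a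
  drawing, CC and its three edges would lie in one face of the theta curve. But by the Jordan curve
  theorem a face of a theta curve is bounded by only two of its three arcs.
\<close>

section \<open>Theta curves in the plane\<close>

text \<open>All three arcs run in the same direction, so the loop through two of them follows one
  forwards and the other backwards, and its winding number is the difference of theirs.\<close>

definition theta :: "(real \<Rightarrow> complex) \<Rightarrow> (real \<Rightarrow> complex) \<Rightarrow> (real \<Rightarrow> complex) \<Rightarrow> bool" where
  "theta P Q R \<longleftrightarrow> arc P \<and> arc Q \<and> arc R
     \<and> pathstart Q = pathstart P \<and> pathstart R = pathstart P
     \<and> pathfinish Q = pathfinish P \<and> pathfinish R = pathfinish P
     \<and> path_image P \<inter> path_image Q = {pathstart P, pathfinish P}
     \<and> path_image P \<inter> path_image R = {pathstart P, pathfinish P}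
     \<and> path_image Q \<inter> path_image R = {pathstart P, pathfinish P}"

lemma theta_swap: "theta P Q R \<Longrightarrow> theta Q P R"
  and theta_rotate: "theta P Q R \<Longrightarrow> theta Q R P"
  by (simp_all add: theta_def Int_commute)

lemma theta_simple_loop:
  assumes "theta P Q R"
  shows "simple_path (P +++ reversepath Q)"
    and "path_image (P +++ reversepath Q) = path_image P \<union> path_image Q"
    and "pathfinish (P +++ reversepath Q) = pathstart (P +++ reversepath Q)"
  using assms by (auto simp: theta_def path_image_join intro!: simple_path_join_loop arc_reversepath)

section \<open>Insides and winding numbers of the three loops of a theta curve\<close>

lemma theta_Jordan:
  assumes "theta P Q R"
  shows "inside (path_image P \<union> path_image Q) \<noteq> {}"
    and "Topological_Spaces.connected (inside (path_image P \<union> path_image Q))"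
    and "frontier (inside (path_image P \<union> path_image Q)) = path_image P \<union> path_image Q"
  using Jordan_inside_outside[OF theta_simple_loop(1,3)[OF assms]] theta_simple_loop(2)[OF assms]
  by auto

text \<open>The loop \<open>P +++ reversepath Q\<close> winds around \<open>z\<close> once, in one
  of the two directions, if \<open>z\<close> is inside, and not at all if \<open>z\<close> is
  outside. Not being inside thus becomes an equation between winding numbers of arcs, which is
  transitive.\<close>

lemma theta_winding_number:
  assumes "theta P Q R" "z \<notin> path_image P" "z \<notin> path_image Q"
  shows "winding_number P z = winding_number Q z
           \<longleftrightarrow> z \<notin> inside (path_image P \<union> path_image Q)"
proof -
  let ?l = "P +++ reversepath Q"
  have w: "winding_number ?l z = winding_number P z - winding_number Q z"
    using assms by (simp add: theta_def winding_number_join winding_number_reversepath arc_imp_path)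
  show ?thesis
  proof (cases "z \<in> inside (path_image P \<union> path_image Q)")
    case True
    then have "z \<in> inside (path_image ?l)"
      by (simp add: theta_simple_loop(2)[OF assms(1)])
    then have "winding_number ?l z \<noteq> 0"
      using simple_closed_path_winding_number_inside[OF theta_simple_loop(1)[OF assms(1)]]
      by (metis one_neq_zero neg_equal_0_iff_equal)
    with True w show ?thesis by auto
  next
    case False
    then have "z \<in> outside (path_image ?l)"
      using assms(2,3) inside_Un_outside[of "path_image P \<union> path_image Q"]
      unfolding theta_simple_loop(2)[OF assms(1)] by blast
    then have "winding_number ?l z = 0"
      using theta_simple_loop(1,3)[OF assms(1)]
      by (intro winding_number_zero_in_outside) (auto simp: simple_path_imp_path)
    with False w show ?thesis by auto
  qed
qed

lemma connected_inside_iff: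
  assumes "Topological_Spaces.connected T" "T \<inter> J = {}" "x \<in> T" "y \<in> T"
  shows "x \<in> inside J \<longleftrightarrow> y \<in> inside J"
proof -
  have "connected_component (- J) x y" "connected_component (- J) y x"
    using assms by (auto simp: connected_component_def)
  then show ?thesis
    by (blast intro: inside_same_component)
qed

text \<open>Neither inside meets the other loop, so a common point would make them equal by
  connectedness. Then the two loops, as their frontiers, would agree as well.\<close>

lemma theta_insides_disjoint:
  assumes th: "theta P Q R"
    and R: "path_image R \<inter> inside (path_image P \<union> path_image Q) = {}"
    and Q: "path_image Q \<inter> inside (path_image P \<union> path_image R) = {}"
  shows "inside (path_image P \<union> path_image Q) \<inter> inside (path_image P \<union> path_image R) = {}"
proof (rule ccontr)
  let ?PQ = "path_image P \<union> path_image Q" and ?PR = "path_image P \<union> path_image R"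
  have th': "theta P R Q"
    using th theta_swap theta_rotate by metis
  assume "inside ?PQ \<inter> inside ?PR \<noteq> {}"
  then obtain z where z: "z \<in> inside ?PQ" "z \<in> inside ?PR"
    by blast
  have "inside ?PQ \<inter> ?PR = {}" "inside ?PR \<inter> ?PQ = {}"
    using Q R inside_no_overlap[of ?PQ] inside_no_overlap[of ?PR] by blast+
  then have "inside ?PQ \<subseteq> inside ?PR" "inside ?PR \<subseteq> inside ?PQ"
    using z connected_inside_iff theta_Jordan(2)[OF th] theta_Jordan(2)[OF th'] by blast+
  then have "frontier (inside ?PQ) = frontier (inside ?PR)"
    by simp
  then have "?PQ = ?PR"
    using theta_Jordan(3)[OF th] theta_Jordan(3)[OF th'] by simp
  \<comment> \<open>A point of \<open>Q\<close> would now lie on \<open>P\<close> or on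
    \<open>R\<close>, and these meet \<open>Q\<close> only at its ends.\<close>
  then have "path_image Q = path_image P \<inter> path_image Q \<union> path_image Q \<inter> path_image R"
    by blast
  also have "\<dots> = {pathstart Q, pathfinish Q}"
    using th by (simp add: theta_def)
  finally have "path_image Q - {pathstart Q, pathfinish Q} = {}"
    by simp
  then show False
    using nonempty_simple_path_endless[of Q] th by (auto simp: theta_def arc_imp_simple_path)
qed

text \<open>
  The three loops of a theta curve have winding numbers that add up to 0, so a point cannot be
  inside exactly one of them.
\<close>

lemma theta_arc_inside:
  assumes th: "theta P Q R"
  shows "path_image R \<inter> inside (path_image P \<union> path_image Q) \<noteq> {}
       \<or> path_image Q \<inter> inside (path_image P \<union> path_image R) \<noteq> {}
       \<or> path_image P \<inter> inside (path_image Q \<union> path_image R) \<noteq> {}"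
proof (rule ccontr)
  assume "\<not> ?thesis"
  then have R: "path_image R \<inter> inside (path_image P \<union> path_image Q) = {}"
    and Q: "path_image Q \<inter> inside (path_image P \<union> path_image R) = {}"
    and P: "path_image P \<inter> inside (path_image Q \<union> path_image R) = {}"
    by auto
  obtain z where z: "z \<in> inside (path_image P \<union> path_image Q)"
    using theta_Jordan(1)[OF th] by blast
  then have zn: "z \<notin> path_image P" "z \<notin> path_image Q" "z \<notin> path_image R"
    using R inside_no_overlap[of "path_image P \<union> path_image Q"] by blast+
  have th1: "theta P R Q" and th2: "theta Q R P"
    using th theta_swap theta_rotate by metis+
  have "z \<notin> inside (path_image P \<union> path_image R)"
    using theta_insides_disjoint[OF th R Q] z by blast
  moreover have "z \<notin> inside (path_image Q \<union> path_image R)"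
    using theta_insides_disjoint[OF theta_swap[OF th]] R P z by (auto simp: Un_commute)
  \<comment> \<open>Both sides equal the winding number of \<open>R\<close>, because
    \<open>z\<close> is inside neither loop through \<open>R\<close>.\<close>
  ultimately have "winding_number P z = winding_number Q z"
    using theta_winding_number[OF th1 zn(1,3)] theta_winding_number[OF th2 zn(2,3)] by simp
  then show False
    using theta_winding_number[OF th] zn z by simp
qed

text \<open>Here \<open>R\<close> cuts the inside of the loop of \<open>P\<close> and
  \<open>Q\<close> into the insides of the other two loops. As \<open>r\<close> is a limit point of
  \<open>S\<close>, the set \<open>S\<close> lies in one of these halves; then \<open>p\<close> or
  \<open>q\<close> would be inside the large loop although it lies on it.\<close>

lemma theta_face_frontier_aux:
  assumes th: "theta P Q R"
    and R: "path_image R \<inter> inside (path_image P \<union> path_image Q) \<noteq> {}"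
    and S: "Topological_Spaces.connected S" "S \<inter> (path_image P \<union> path_image Q \<union> path_image R) = {}"
    and p: "p \<in> closure S" "p \<in> path_image P" "p \<notin> {pathstart P, pathfinish P}"
    and q: "q \<in> closure S" "q \<in> path_image Q" "q \<notin> {pathstart P, pathfinish P}"
    and r: "r \<in> closure S" "r \<in> path_image R" "r \<notin> {pathstart P, pathfinish P}"
  shows False
proof -
  let ?P = "path_image P" and ?Q = "path_image Q" and ?R = "path_image R"
  let ?e = "{pathstart P, pathfinish P}"
  have int: "?P \<inter> ?Q = ?e" "?P \<inter> ?R = ?e" "?Q \<inter> ?R = ?e"
    using th by (auto simp: theta_def)
  have eq: "inside (?P \<union> ?R) \<union> inside (?Q \<union> ?R) \<union> (?R - ?e) = inside (?P \<union> ?Q)"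
    by (rule split_inside_simple_closed_curve[of P "pathstart P" "pathfinish P" Q R])
      (use th R in \<open>auto simp: theta_def arc_imp_simple_path dest: arc_distinct_ends\<close>)
  obtain s where s: "s \<in> S"
    using p(1) by (cases "S = {}") auto
  \<comment> \<open>A limit point \<open>x\<close> can be added to \<open>S\<close> without losing
    connectedness, so it is on the same side of \<open>J\<close> as \<open>s\<close>.\<close>
  have lim: "s \<in> inside J \<longleftrightarrow> x \<in> inside J"
    if "x \<in> closure S" "x \<notin> J" "J \<subseteq> ?P \<union> ?Q \<union> ?R" for x J
  proof (rule connected_inside_iff[of "insert x S"])
    show "Topological_Spaces.connected (insert x S)"
      using that(1) closure_subset by (intro connected_intermediate_closure[OF S(1)]) auto
  qed (use that S s in auto)
  have "r \<in> inside (?P \<union> ?Q)"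
    using eq r by blast
  then have "s \<in> inside (?P \<union> ?Q)"
    using lim[of r "?P \<union> ?Q"] r int by blast
  then have "s \<in> inside (?P \<union> ?R) \<or> s \<in> inside (?Q \<union> ?R)"
    using eq S s by blast
  \<comment> \<open>The limit point on the arc that does not bound the half containing
    \<open>s\<close> must itself lie in that half.\<close>
  then have "q \<in> inside (?P \<union> ?R) \<or> p \<in> inside (?Q \<union> ?R)"
    using lim[of q "?P \<union> ?R"] lim[of p "?Q \<union> ?R"] p q int by blast
  then have "q \<in> inside (?P \<union> ?Q) \<or> p \<in> inside (?P \<union> ?Q)"
    using eq by blast
  then show False
    using p q inside_no_overlap[of "?P \<union> ?Q"] by blast
qed

text \<open>By \<open>theta_arc_inside\<close> some arc enters the inside of the loop of the other
  two. The hypotheses are symmetric in the arcs, so \<open>theta_face_frontier_aux\<close> applies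
  after a permutation.\<close>

lemma theta_face_frontier:
  assumes th: "theta P Q R"
    and S: "Topological_Spaces.connected S" "S \<inter> (path_image P \<union> path_image Q \<union> path_image R) = {}"
    and p: "p \<in> closure S" "p \<in> path_image P" "p \<notin> {pathstart P, pathfinish P}"
    and q: "q \<in> closure S" "q \<in> path_image Q" "q \<notin> {pathstart P, pathfinish P}"
    and r: "r \<in> closure S" "r \<in> path_image R" "r \<notin> {pathstart P, pathfinish P}"
  shows False
proof -
  have ends: "pathstart Q = pathstart P" "pathfinish Q = pathfinish P"
    using th by (auto simp: theta_def)
  have th1: "theta P R Q" and th2: "theta Q R P"
    using th theta_swap theta_rotate by metis+
  consider "path_image R \<inter> inside (path_image P \<union> path_image Q) \<noteq> {}"
    | "path_image Q \<inter> inside (path_image P \<union> path_image R) \<noteq> {}"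
    | "path_image P \<inter> inside (path_image Q \<union> path_image R) \<noteq> {}"
    using theta_arc_inside[OF th] by blast
  then show False
  proof cases
    case 1
    then show False using theta_face_frontier_aux[OF th 1 S(1) _ p q r] S(2) by blast
  next
    case 2
    then show False using theta_face_frontier_aux[OF th1 2 S(1) _ p r q] S(2) by blast
  next
    case 3
    then show False
      using theta_face_frontier_aux[OF th2 3 S(1) _ q(1,2) _ r(1,2) _ p(1,2)] p q r S(2) ends by auto
  qed
qed

text \<open>The end is attained only at parameter 1, so what remains is the image of the interval
  \<open>{0..<1}\<close>, whose closure contains 1.\<close>

lemma arc_half_open:
  fixes g :: "real \<Rightarrow> 'a::t2_space"
  assumes "arc g"
  shows "Topological_Spaces.connected (path_image g - {pathfinish g})"
    and "pathfinish g \<in> closure (path_image g - {pathfinish g})"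
proof -
  have cont: "continuous_on {0..1} g" and inj: "inj_on g {0..1}"
    using assms by (auto simp: arc_def path_def)
  have eq: "path_image g - {pathfinish g} = g ` {0..<1}"
    using inj_on_image_set_diff[OF inj, of "{0..1}" "{1}"]
    by (simp add: path_image_def pathfinish_def atLeastLessThan_eq_atLeastAtMost_diff)
  show "Topological_Spaces.connected (path_image g - {pathfinish g})"
    unfolding eq
    by (intro connected_continuous_image continuous_on_subset[OF cont]) auto
  have "g ` closure {0..<1} \<subseteq> closure (g ` {0..<1})"
    using cont by (intro image_closure_subset) (auto simp: closure_subset)
  then show "pathfinish g \<in> closure (path_image g - {pathfinish g})"
    unfolding eq by (auto simp: pathfinish_def)
qed

section \<open>Paths in plane drawings\<close>

fun walk_edges :: "'a list \<Rightarrow> 'a set set" where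
  "walk_edges (u # v # xs) = insert {u, v} (walk_edges (v # xs))"
| "walk_edges _ = {}"

lemma walk_edges_subset: "E \<in> walk_edges xs \<Longrightarrow> E \<subseteq> set xs"
  by (induction xs rule: walk_edges.induct) auto

lemma Union_walk_edges: "\<Union> (walk_edges (u # v # xs)) = set (u # v # xs)"
  by (induction xs arbitrary: u v) auto

text \<open>A one-vertex list is a path from a vertex to itself and has no edges; lemmas that need
  an edge therefore assume \<open>u \<noteq> v\<close>.\<close>

definition upath_between :: "'a pair_pre_digraph \<Rightarrow> 'a \<Rightarrow> 'a \<Rightarrow> 'a list \<Rightarrow> bool" where
  "upath_between G u v xs \<longleftrightarrow> xs \<noteq> [] \<and> hd xs = u \<and> last xs = v \<and> distinct xs
     \<and> set xs \<subseteq> pverts G \<and> walk_edges xs \<subseteq> uedges G"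

lemma upath_between_Union_edges:
  assumes "upath_between G u v xs" "u \<noteq> v"
  shows "\<Union> (walk_edges xs) = set xs"
  using assms by (cases xs rule: walk_edges.cases) (simp_all add: upath_between_def Union_walk_edges del: walk_edges.simps(1) Union_iff)

section \<open>Arcs drawn for edges and paths\<close>

context
  fixes G :: "'a pair_pre_digraph" and \<phi> \<gamma>
  assumes drawing: "plane_drawing G \<phi> \<gamma>"
begin

lemma drawing_edge_Int:
  "\<lbrakk>E \<in> uedges G; F \<in> uedges G; E \<noteq> F\<rbrakk> \<Longrightarrow> path_image (\<gamma> E) \<inter> path_image (\<gamma> F) = \<phi> ` (E \<inter> F)"
  using drawing by (auto simp: plane_drawing_def)

lemma drawing_inj: "inj_on \<phi> (pverts G)"
  using drawing by (simp add: plane_drawing_def)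

text \<open>A drawing fixes no direction for the curve of an edge, so the curve may have to be
  reversed. It is an arc because \<open>\<phi>\<close> separates the two ends.\<close>

lemma drawing_edge_arc:
  assumes "{u, v} \<in> uedges G" "u \<in> pverts G" "v \<in> pverts G" "u \<noteq> v"
  obtains g where "arc g" "pathstart g = \<phi> u" "pathfinish g = \<phi> v"
    "path_image g = path_image (\<gamma> {u, v})"
proof -
  let ?g = "\<gamma> {u, v}"
  have g: "simple_path ?g" "{pathstart ?g, pathfinish ?g} = {\<phi> u, \<phi> v}"
    using drawing assms(1) by (auto simp: plane_drawing_def)
  have "\<phi> u \<noteq> \<phi> v"
    using drawing_inj assms by (auto simp: inj_on_def)
  then have "arc ?g"
    using g by (auto simp: arc_simple_path doubleton_eq_iff)
  from g(2) consider "pathstart ?g = \<phi> u" "pathfinish ?g = \<phi> v"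
    | "pathstart ?g = \<phi> v" "pathfinish ?g = \<phi> u"
    by (auto simp: doubleton_eq_iff)
  then show thesis
  proof cases
    case 1
    with \<open>arc ?g\<close> that[of ?g] show thesis by simp
  next
    case 2
    with \<open>arc ?g\<close> that[of "reversepath ?g"] show thesis by (simp add: arc_reversepath)
  qed
qed

text \<open>The arcs of the edges are joined one after another. Two explicit leading vertices
  guarantee at least one edge, since a single point is not an arc.\<close>

lemma drawing_walk_arc:
  assumes "distinct (u # v # xs)" "set (u # v # xs) \<subseteq> pverts G"
    "walk_edges (u # v # xs) \<subseteq> uedges G"
  shows "\<exists>g. arc g \<and> pathstart g = \<phi> u \<and> pathfinish g = \<phi> (last (v # xs))
           \<and> path_image g = (\<Union>E\<in>walk_edges (u # v # xs). path_image (\<gamma> E))"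
  using assms
proof (induction xs arbitrary: u v)
  case Nil
  then obtain g where "arc g" "pathstart g = \<phi> u" "pathfinish g = \<phi> v"
    "path_image g = path_image (\<gamma> {u, v})"
    using drawing_edge_arc[of u v] by auto
  then show ?case by auto
next
  case (Cons w ys)
  obtain h where h: "arc h" "pathstart h = \<phi> v" "pathfinish h = \<phi> (last (w # ys))"
    "path_image h = (\<Union>E\<in>walk_edges (v # w # ys). path_image (\<gamma> E))"
    using Cons.IH[of v w] Cons.prems by auto
  obtain g where g: "arc g" "pathstart g = \<phi> u" "pathfinish g = \<phi> v"
    "path_image g = path_image (\<gamma> {u, v})"
    using drawing_edge_arc[of u v] Cons.prems by auto
  \<comment> \<open>As \<open>u\<close> does not recur, it lies on no later edge: the first edge
    differs from every later one and can meet it only at \<open>v\<close>.\<close>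
  have "path_image (\<gamma> {u, v}) \<inter> path_image (\<gamma> E) \<subseteq> {\<phi> v}" if "E \<in> walk_edges (v # w # ys)" for E
  proof -
    have "u \<notin> E"
      using walk_edges_subset[OF that] Cons.prems(1) by auto
    moreover from this have "path_image (\<gamma> {u, v}) \<inter> path_image (\<gamma> E) = \<phi> ` ({u, v} \<inter> E)"
      using that Cons.prems(3) by (intro drawing_edge_Int) auto
    ultimately show ?thesis by auto
  qed
  then have "path_image g \<inter> path_image h \<subseteq> {pathstart h}"
    unfolding g(4) h(2,4) by blast
  then have "arc (g +++ h)"
    using g h by (intro arc_join) auto
  moreover have "path_image (g +++ h)
      = (\<Union>E\<in>walk_edges (u # v # w # ys). path_image (\<gamma> E))"
    using g h by (simp add: path_image_join)
  ultimately show ?case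
    using g h by (intro exI[of _ "g +++ h"]) simp
qed

lemma drawing_upath_arc:
  assumes "upath_between G u v xs" "u \<noteq> v"
  obtains g where "arc g" "pathstart g = \<phi> u" "pathfinish g = \<phi> v"
    "path_image g = (\<Union>E\<in>walk_edges xs. path_image (\<gamma> E))"
proof (cases xs rule: walk_edges.cases)
  case (1 a b ys)
  then have "a = u" "last (b # ys) = v"
    using assms(1) by (auto simp: upath_between_def)
  moreover have "distinct (a # b # ys)" "set (a # b # ys) \<subseteq> pverts G"
    "walk_edges (a # b # ys) \<subseteq> uedges G"
    using assms(1) unfolding 1 upath_between_def by blast+
  ultimately obtain g where "arc g" "pathstart g = \<phi> u" "pathfinish g = \<phi> v"
    "path_image g = (\<Union>E\<in>walk_edges xs. path_image (\<gamma> E))"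
    using drawing_walk_arc[of a b ys] unfolding 1 by blast
  then show thesis by (rule that)
qed (use assms in \<open>auto simp: upath_between_def\<close>)

text \<open>Distinct edges meet only in images of common ends, so over all pairs of edges only the
  images of common vertices remain. The vertex condition alone would allow both paths to be the
  single edge from \<open>u\<close> to \<open>v\<close>.\<close>

lemma drawing_upath_Int:
  assumes "upath_between G u v xs" "upath_between G u v ys" "u \<noteq> v"
    and "walk_edges xs \<inter> walk_edges ys = {}" "set xs \<inter> set ys = {u, v}"
  shows "(\<Union>E\<in>walk_edges xs. path_image (\<gamma> E)) \<inter> (\<Union>E\<in>walk_edges ys. path_image (\<gamma> E))
           = {\<phi> u, \<phi> v}"
proof -
  have "path_image (\<gamma> E) \<inter> path_image (\<gamma> F) = \<phi> ` (E \<inter> F)"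
    if "E \<in> walk_edges xs" "F \<in> walk_edges ys" for E F
    using assms that by (intro drawing_edge_Int) (auto simp: upath_between_def)
  then have "(\<Union>E\<in>walk_edges xs. path_image (\<gamma> E)) \<inter> (\<Union>E\<in>walk_edges ys. path_image (\<gamma> E))
      = (\<Union>E\<in>walk_edges xs. \<Union>F\<in>walk_edges ys. \<phi> ` (E \<inter> F))"
    by (simp add: Int_UN_distrib2)
  also have "\<dots> = \<phi> ` (\<Union> (walk_edges xs) \<inter> \<Union> (walk_edges ys))"
    by auto
  also have "\<dots> = {\<phi> u, \<phi> v}"
    using assms by (simp add: upath_between_Union_edges)
  finally show ?thesis .
qed

lemma drawing_vertex_on_walk:
  assumes "upath_between G u v xs" "u \<noteq> v" "w \<in> set xs"
  shows "\<phi> w \<in> (\<Union>E\<in>walk_edges xs. path_image (\<gamma> E))"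
proof -
  obtain E where E: "E \<in> walk_edges xs" "w \<in> E"
    using upath_between_Union_edges[OF assms(1,2)] assms(3) by blast
  then have "E \<in> uedges G"
    using assms(1) by (auto simp: upath_between_def)
  then have "path_image (\<gamma> E) \<inter> \<phi> ` pverts G = \<phi> ` E"
    using drawing by (simp add: plane_drawing_def)
  with E show ?thesis by blast
qed

text \<open>Without its outer end, a spoke stays off every path that misses \<open>c\<close>, yet
  keeps that end as a limit point. This is the form in which spokes can make up the set
  \<open>S\<close> of \<open>theta_face_frontier\<close>.\<close>

lemma drawing_spoke:
  assumes "{c, w} \<in> uedges G" "c \<in> pverts G" "w \<in> pverts G" "c \<noteq> w"
  shows "Topological_Spaces.connected (path_image (\<gamma> {c, w}) - {\<phi> w})"
    and "\<phi> w \<in> closure (path_image (\<gamma> {c, w}) - {\<phi> w})"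
    and "\<phi> c \<in> path_image (\<gamma> {c, w}) - {\<phi> w}"
    and "\<lbrakk>upath_between G u v xs; c \<notin> set xs\<rbrakk> \<Longrightarrow>
           (path_image (\<gamma> {c, w}) - {\<phi> w}) \<inter> (\<Union>E\<in>walk_edges xs. path_image (\<gamma> E)) = {}"
proof -
  obtain g where g: "arc g" "pathstart g = \<phi> c" "pathfinish g = \<phi> w"
    "path_image g = path_image (\<gamma> {c, w})"
    using drawing_edge_arc assms by blast
  show "Topological_Spaces.connected (path_image (\<gamma> {c, w}) - {\<phi> w})"
    and "\<phi> w \<in> closure (path_image (\<gamma> {c, w}) - {\<phi> w})"
    using arc_half_open[OF g(1)] g by auto
  show "\<phi> c \<in> path_image (\<gamma> {c, w}) - {\<phi> w}"
    using g arc_distinct_ends[OF g(1)] pathstart_in_path_image[of g] by auto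
  assume xs: "upath_between G u v xs" "c \<notin> set xs"
  have "path_image (\<gamma> {c, w}) \<inter> path_image (\<gamma> E) \<subseteq> {\<phi> w}" if "E \<in> walk_edges xs" for E
  proof -
    have "c \<notin> E"
      using walk_edges_subset[OF that] xs(2) by blast
    moreover from this have "path_image (\<gamma> {c, w}) \<inter> path_image (\<gamma> E) = \<phi> ` ({c, w} \<inter> E)"
      using that xs assms(1) by (intro drawing_edge_Int) (auto simp: upath_between_def)
    ultimately show ?thesis by auto
  qed
  then show "(path_image (\<gamma> {c, w}) - {\<phi> w}) \<inter> (\<Union>E\<in>walk_edges xs. path_image (\<gamma> E)) = {}"
    by blast
qed

text \<open>The two sides of the subdivided K(3,3) are \<open>{u, v, c}\<close> and
  \<open>{x, y, z}\<close>. The shortened spokes form a connected set off the theta curve that has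
  an inner point of each arc as a limit point, against \<open>theta_face_frontier\<close>.\<close>

lemma no_drawing_K33_subdivision:
  assumes "u \<noteq> v"
    and paths: "upath_between G u v xs" "upath_between G u v ys" "upath_between G u v zs"
    and edges: "walk_edges xs \<inter> walk_edges ys = {}" "walk_edges xs \<inter> walk_edges zs = {}"
      "walk_edges ys \<inter> walk_edges zs = {}"
    and verts: "set xs \<inter> set ys = {u, v}" "set xs \<inter> set zs = {u, v}" "set ys \<inter> set zs = {u, v}"
    and c: "c \<in> pverts G" "c \<notin> set xs" "c \<notin> set ys" "c \<notin> set zs"
    and inner: "x \<in> set xs - {u, v}" "y \<in> set ys - {u, v}" "z \<in> set zs - {u, v}"
    and spokes: "{c, x} \<in> uedges G" "{c, y} \<in> uedges G" "{c, z} \<in> uedges G"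
  shows False
proof -
  obtain P where P: "arc P" "pathstart P = \<phi> u" "pathfinish P = \<phi> v"
    "path_image P = (\<Union>E\<in>walk_edges xs. path_image (\<gamma> E))"
    using drawing_upath_arc[OF paths(1) assms(1)] .
  obtain Q where Q: "arc Q" "pathstart Q = \<phi> u" "pathfinish Q = \<phi> v"
    "path_image Q = (\<Union>E\<in>walk_edges ys. path_image (\<gamma> E))"
    using drawing_upath_arc[OF paths(2) assms(1)] .
  obtain R where R: "arc R" "pathstart R = \<phi> u" "pathfinish R = \<phi> v"
    "path_image R = (\<Union>E\<in>walk_edges zs. path_image (\<gamma> E))"
    using drawing_upath_arc[OF paths(3) assms(1)] .
  have int: "path_image P \<inter> path_image Q = {\<phi> u, \<phi> v}" "path_image P \<inter> path_image R = {\<phi> u, \<phi> v}"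
    "path_image Q \<inter> path_image R = {\<phi> u, \<phi> v}"
    unfolding P(4) Q(4) R(4) using paths edges verts assms(1) by (simp_all add: drawing_upath_Int)
  have th: "theta P Q R"
    using P(1-3) Q(1-3) R(1-3) int by (simp add: theta_def)
  have "u \<in> set xs" "v \<in> set xs"
    using verts(1) by blast+
  moreover have "set xs \<subseteq> pverts G" "set ys \<subseteq> pverts G" "set zs \<subseteq> pverts G"
    using paths by (simp_all add: upath_between_def)
  ultimately have mem: "x \<in> pverts G" "y \<in> pverts G" "z \<in> pverts G"
    "u \<in> pverts G" "v \<in> pverts G"
    using inner by blast+
  have ne: "c \<noteq> x" "c \<noteq> y" "c \<noteq> z"
    using c inner by blast+
  let ?S = "\<lambda>w. path_image (\<gamma> {c, w}) - {\<phi> w}"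
  let ?T = "?S x \<union> ?S y \<union> ?S z"
  note sx = drawing_spoke[OF spokes(1) c(1) mem(1) ne(1)]
    and sy = drawing_spoke[OF spokes(2) c(1) mem(2) ne(2)]
    and sz = drawing_spoke[OF spokes(3) c(1) mem(3) ne(3)]
  \<comment> \<open>All three spokes contain \<open>\<phi> c\<close>.\<close>
  have "Topological_Spaces.connected (?S x \<union> ?S y)"
    using sx(3) sy(3) by (intro connected_Un[OF sx(1) sy(1)]) blast
  then have con: "Topological_Spaces.connected ?T"
    using sx(3) sz(3) by (intro connected_Un[OF _ sz(1)]) blast+
  have disj: "?T \<inter> (path_image P \<union> path_image Q \<union> path_image R) = {}"
    unfolding P(4) Q(4) R(4)
    using sx(4)[OF paths(1) c(2)] sx(4)[OF paths(2) c(3)] sx(4)[OF paths(3) c(4)]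
      sy(4)[OF paths(1) c(2)] sy(4)[OF paths(2) c(3)] sy(4)[OF paths(3) c(4)]
      sz(4)[OF paths(1) c(2)] sz(4)[OF paths(2) c(3)] sz(4)[OF paths(3) c(4)]
    by (simp only: Int_Un_distrib Int_Un_distrib2 Un_empty simp_thms)
  have cl: "\<phi> x \<in> closure ?T" "\<phi> y \<in> closure ?T" "\<phi> z \<in> closure ?T"
    using sx(2) sy(2) sz(2) by (simp_all add: closure_Un)
  have on: "\<phi> x \<in> path_image P" "\<phi> y \<in> path_image Q" "\<phi> z \<in> path_image R"
    unfolding P(4) Q(4) R(4)
    using drawing_vertex_on_walk[OF paths(1) assms(1)] drawing_vertex_on_walk[OF paths(2) assms(1)]
      drawing_vertex_on_walk[OF paths(3) assms(1)] inner
    by blast+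
  have ends: "\<phi> x \<notin> {pathstart P, pathfinish P}" "\<phi> y \<notin> {pathstart P, pathfinish P}"
    "\<phi> z \<notin> {pathstart P, pathfinish P}"
    unfolding P(2,3) using inner by (simp_all add: inj_on_eq_iff[OF drawing_inj] mem)
  show False
    by (rule theta_face_frontier[OF th con disj cl(1) on(1) ends(1) cl(2) on(2) ends(2)
          cl(3) on(3) ends(3)])
qed

end

section \<open>The Hanoi-Fibonacci graph\<close>

text \<open>The parameters \<open>a\<close> and \<open>b\<close> are the pegs of disks 1 and 2. The
  larger disks rest on \<open>PegA\<close>, where they never hinder these two.\<close>

definition two_disk_state :: "nat \<Rightarrow> peg \<Rightarrow> peg \<Rightarrow> hanoi_state" where
  "two_disk_state n a b = (\<lambda>p. (if p = a then {1} else {}) \<union> (if p = b then {2} else {})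
     \<union> (if p = PegA then {3..n} else {}))"

lemma two_disk_state_eq_iff [simp]:
  "two_disk_state n a b = two_disk_state n a' b' \<longleftrightarrow> a = a' \<and> b = b'"
proof
  assume eq: "two_disk_state n a b = two_disk_state n a' b'"
  have "1 \<in> two_disk_state n a' b' a" "2 \<in> two_disk_state n a' b' b"
    unfolding eq[symmetric] by (auto simp: two_disk_state_def)
  then show "a = a' \<and> b = b'"
    by (auto simp: two_disk_state_def split: if_splits)
qed simp

lemma two_disk_state_in_hanoi_states:
  assumes "n \<ge> 2"
  shows "two_disk_state n a b \<in> hanoi_states n"
proof -
  have "(\<Union>p. two_disk_state n a b p) = {1} \<union> {2} \<union> {3..n}"
    by (auto simp: two_disk_state_def split: if_splits)
  also have "\<dots> = disks n"
    using assms by (auto simp: disks_def)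
  finally show ?thesis
    by (auto simp: hanoi_states_def two_disk_state_def)
qed

text \<open>For \<open>k = 1\<close> both \<open>disks (k - 1)\<close> and
  \<open>disks (k - 2)\<close> are empty, so disk 1 travels alone between any two pegs, and the
  third peg \<open>y\<close>, in the role of \<open>Y\<close>, keeps its content.\<close>

lemma move_disk_1:
  assumes "n \<ge> 2" "a \<noteq> a'"
  shows "fibonacci_move n (two_disk_state n a b) (two_disk_state n a' b)"
proof -
  obtain y where y: "y \<noteq> a" "y \<noteq> a'"
    by (metis peg.distinct)
  let ?e = "two_disk_state n a b" and ?e' = "two_disk_state n a' b"
  have "fibonacci_move_of 1 ?e ?e'"
    unfolding fibonacci_move_of_def
    \<comment> \<open>After the move peg \<open>a\<close> has lost disk 1, so its new content is the
      remainder \<open>X'\<close>.\<close>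
    by (rule exI[of _ a], rule exI[of _ y], rule exI[of _ a'], rule exI[of _ "?e' a"],
        rule exI[of _ "?e y"])
      (use assms y in \<open>auto simp: two_disk_state_def disks_def\<close>)
  then show ?thesis
    using assms by (auto simp: fibonacci_move_def disks_def)
qed

text \<open>For \<open>k = 2\<close> the set \<open>disks (k - 1)\<close> is disk 1 alone and
  \<open>disks (k - 2)\<close> is empty, so both small disks land on the third peg. Peg
  \<open>b\<close>, with disk 2, is \<open>X\<close>, and peg \<open>a\<close> is
  \<open>Y\<close>.\<close>

lemma move_disks_1_2:
  assumes "n \<ge> 2" "a \<noteq> b" "b \<noteq> c" "a \<noteq> c"
  shows "fibonacci_move n (two_disk_state n a b) (two_disk_state n c c)"
proof -
  let ?e = "two_disk_state n a b" and ?e' = "two_disk_state n c c"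
  have "fibonacci_move_of 2 ?e ?e'"
    unfolding fibonacci_move_of_def
    by (rule exI[of _ b], rule exI[of _ a], rule exI[of _ c], rule exI[of _ "?e' b"],
        rule exI[of _ "?e' a"])
      (use assms in \<open>auto simp: two_disk_state_def disks_def\<close>)
  then show ?thesis
    using assms by (auto simp: fibonacci_move_def disks_def)
qed

text \<open>Stated in both orders because a path may cross an arc against its direction.\<close>

lemma uedges_hanoi_fibonacci:
  assumes "fibonacci_move n e e'" "e \<in> hanoi_states n" "e' \<in> hanoi_states n"
  shows "{e, e'} \<in> uedges (mk_symmetric (with_proj (hanoi_fibonacci n)))"
    and "{e', e} \<in> uedges (mk_symmetric (with_proj (hanoi_fibonacci n)))"
  using assms by (force simp: uedges_def parcs_mk_symmetric hanoi_fibonacci_def)+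

theorem theorem2p11:
  fixes n :: nat
  assumes "n \<ge> 2"
  shows "\<not> planar (mk_symmetric (with_proj (hanoi_fibonacci n)))"
proof
  let ?G = "mk_symmetric (with_proj (hanoi_fibonacci n))" and ?s = "two_disk_state n"
  assume "planar ?G"
  then obtain \<phi> \<gamma> where drawing: "plane_drawing ?G \<phi> \<gamma>"
    by (auto simp: planar_def)
  have verts: "?s a b \<in> pverts ?G" for a b
    using two_disk_state_in_hanoi_states[OF assms] by (simp add: hanoi_fibonacci_def)
  have e1: "{?s a b, ?s a' b} \<in> uedges ?G" if "a \<noteq> a'" for a a' b
    using that assms
    by (intro uedges_hanoi_fibonacci move_disk_1 two_disk_state_in_hanoi_states)
  have e2: "{?s a b, ?s c c} \<in> uedges ?G" "{?s c c, ?s a b} \<in> uedges ?G"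
    if "a \<noteq> b" "b \<noteq> c" "a \<noteq> c" for a b c
    using that assms
    by (intro uedges_hanoi_fibonacci move_disks_1_2 two_disk_state_in_hanoi_states; simp)+
  \<comment> \<open>Double moves are the last edge of \<open>?xs\<close>, the first edge of
    \<open>?ys\<close> and both outer edges of \<open>?zs\<close>; those at the initial vertex are
    crossed backwards. All other edges move disk 1.\<close>
  let ?xs = "[?s PegA PegA, ?s PegB PegA, ?s PegC PegA, ?s PegB PegB]"
    and ?ys = "[?s PegA PegA, ?s PegC PegB, ?s PegA PegB, ?s PegB PegB]"
    and ?zs = "[?s PegA PegA, ?s PegB PegC, ?s PegA PegC, ?s PegB PegB]"
  have paths: "upath_between ?G (?s PegA PegA) (?s PegB PegB) ?xs"
    "upath_between ?G (?s PegA PegA) (?s PegB PegB) ?ys"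
    "upath_between ?G (?s PegA PegA) (?s PegB PegB) ?zs"
    by (simp_all add: upath_between_def verts e1 e2 del: pverts_mk_symmetric)
  \<comment> \<open>The spokes from the hub to \<open>x\<close> and \<open>y\<close> are double
    moves into the hub; the one to \<open>z\<close> moves disk 1.\<close>
  show False
    by (rule no_drawing_K33_subdivision[OF drawing _ paths, where c = "?s PegC PegC"
          and x = "?s PegB PegA" and y = "?s PegA PegB" and z = "?s PegA PegC"])
      (simp_all add: verts e1 e2 doubleton_eq_iff del: pverts_mk_symmetric)
qed

end
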